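(* Let $X$ be a random vector taking values in $\mathfrak X\subset\mathbb{R}^d$ and let $Y$ be a Bernoulli (i.e. $\{0,1\}$-valued) random variable defined on the same probability space $(\Omega,\mathcal A,\mathbf P)$. Write $\kappa(x):=\mathbf E(Y|X=x)$. Then: (i) If there are $\beta_0\in\mathcal S^{d-1}$ and a random variable $U$ such that $\mathrm{med}(U|X)=0$ and $Y=\mathbf 1_{U+\beta_0^\top X\ge0}$, then $\beta_0^\top x\,(\kappa(x)-1/2)\ge0$ for all $x\in\mathfrak X$. (ii) Conversely, assume that the event $[\kappa(X)\in\{0,1/2,1\}]$ has probability $0$ and that, for some $\beta_0\in\mathcal S^{d-1}$, $\beta_0^\top x\,(\kappa(x)-1/2)\ge0$ for all $x\in\mathfrak X^\circ$. Then there is a probability measure $\mu$ on $\mathbb{R}^{d+1}$ such that if $(V,U)\sim\mu$, then $V\stackrel{\mathscr D}{=}X$, $\mathrm{med}(U|V)=0$ and $(X,Y)\stackrel{\mathscr D}{=}(V,W)$, where $W=\mathbf 1_{U+\beta_0^\top V\ge0}$. (iii) Moreover, if $(\Omega,\mathcal A,\mathbf P)$ admits a continuous, symmetric random variable $Z$ with a strictly increasing distribution function that is independent of $X$, then $V$ in (ii) can be taken to be identically equal to $X$.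
   Context: $\mathcal S^{d-1}$ is the Euclidean unit sphere in $\mathbb{R}^d$, where $d\ge2$; $\mathfrak X$ is a closed convex subset of $\mathbb{R}^d$ with nonempty interior $\mathfrak X^\circ$; by standing assumption in the paper $\mathfrak X$ is compact and $X$ has a continuous distribution with a strictly positive density on $\mathfrak X^\circ$. $\mathrm{med}(U|X)$ denotes the conditional median of $U$ given $X$, and $\mathrm{med}(U|X)=0$ is understood almost surely. $\stackrel{\mathscr D}{=}$ denotes equality in distribution and $\mathbf 1$ an indicator. *)

theory Defs
  imports "HOL-Probability.Probability"
begin

definition sigma_gen :: "'a measure \<Rightarrow> ('a \<Rightarrow> 'b::topological_space) \<Rightarrow> 'a measure" where
  "sigma_gen M X = vimage_algebra (space M) X borel"

text \<open>A version of the regression function: conditional expectations are unique only up to null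
  sets, so \<open>\<kappa>\<close> is determined only almost everywhere with respect to the law of \<open>X\<close>.\<close>

definition regression_version ::
  "'a measure \<Rightarrow> ('a \<Rightarrow> 'b::topological_space) \<Rightarrow> ('a \<Rightarrow> real) \<Rightarrow> ('b \<Rightarrow> real) \<Rightarrow> bool" where
  "regression_version M X Y \<kappa> \<longleftrightarrow>
     \<kappa> \<in> borel_measurable borel \<and>
     (AE \<omega> in M. real_cond_exp M (sigma_gen M X) Y \<omega> = \<kappa> (X \<omega>))"

definition cond_prob_given ::
  "'a measure \<Rightarrow> ('a \<Rightarrow> 'b::topological_space) \<Rightarrow> ('a \<Rightarrow> bool) \<Rightarrow> 'a \<Rightarrow> real" where
  "cond_prob_given M X P = real_cond_exp M (sigma_gen M X) (\<lambda>\<omega>. of_bool (P \<omega>))"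

text \<open>\<open>m\<close> is a conditional median of \<open>U\<close> given \<open>X\<close>; as usual for medians, uniqueness is not
  required.\<close>

definition is_cond_median ::
  "'a measure \<Rightarrow> ('a \<Rightarrow> 'b::topological_space) \<Rightarrow> ('a \<Rightarrow> real) \<Rightarrow> real \<Rightarrow> bool" where
  "is_cond_median M X U m \<longleftrightarrow>
     (AE \<omega> in M. cond_prob_given M X (\<lambda>\<omega>. U \<omega> \<le> m) \<omega> \<ge> 1/2 \<and>
                 cond_prob_given M X (\<lambda>\<omega>. U \<omega> \<ge> m) \<omega> \<ge> 1/2)"

definition binary_response ::
  "'b::real_inner \<Rightarrow> ('a \<Rightarrow> 'b) \<Rightarrow> ('a \<Rightarrow> real) \<Rightarrow> 'a \<Rightarrow> real" where
  "binary_response \<beta> V U \<omega> = of_bool (U \<omega> + \<beta> \<bullet> V \<omega> \<ge> 0)"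

text \<open>The pair \<open>(V, U)\<close> on \<open>N\<close> reproduces the law of \<open>(X, Y)\<close> on \<open>M\<close> through the
  median-zero binary response model with parameter \<open>\<beta>\<close>.\<close>

definition response_representation ::
  "'a measure \<Rightarrow> ('a \<Rightarrow> 'b::euclidean_space) \<Rightarrow> ('a \<Rightarrow> real) \<Rightarrow> 'b \<Rightarrow>
   'c measure \<Rightarrow> ('c \<Rightarrow> 'b) \<Rightarrow> ('c \<Rightarrow> real) \<Rightarrow> bool" where
  "response_representation M X Y \<beta> N V U \<longleftrightarrow>
     V \<in> borel_measurable N \<and> U \<in> borel_measurable N \<and>
     distr N borel V = distr M borel X \<and>
     is_cond_median N V U 0 \<and>
     distr M borel (\<lambda>\<omega>. (X \<omega>, Y \<omega>)) =
       distr N borel (\<lambda>\<omega>. (V \<omega>, binary_response \<beta> V U \<omega>))"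

definition indep_rv ::
  "'a measure \<Rightarrow> ('a \<Rightarrow> 'b::topological_space) \<Rightarrow> ('a \<Rightarrow> 'c::topological_space) \<Rightarrow> bool" where
  \<comment> \<open>\<open>indep_var\<close> forces both variables to have the same value type.\<close>
  "indep_rv M X Z \<longleftrightarrow>
     prob_space.indep_set M (sets (sigma_gen M X)) (sets (sigma_gen M Z))"

end

theory Submission
  imports Defs
begin

text \<open>Write \<open>t = \<beta>\<^sub>0 \<bullet> X\<close>. For (i), \<open>Y \<ge> 1\<^bsub>U \<ge> 0\<^esub>\<close> on \<open>t \<ge> 0\<close> and \<open>1 - Y \<ge> 1\<^bsub>U \<le> 0\<^esub>\<close> on \<open>t < 0\<close>;
  both events are determined by \<open>X\<close>, so the inequalities survive conditioning on \<open>X\<close>.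
  For (ii) and (iii), the hyperplane \<open>t = 0\<close> is a null event, so it is enough to take \<open>U = 0\<close> when
  \<open>Y = 1\<^bsub>t \<ge> 0\<^esub>\<close> and \<open>U = - 2 t\<close> otherwise: the response is then \<open>Y\<close> itself, and \<open>0\<close> is a
  conditional median of \<open>U\<close> exactly because of the sign condition on \<open>\<kappa>\<close>. The measure \<open>\<mu>\<close> is the
  law of \<open>(X, U)\<close>; being a conditional median depends only on that law.\<close>

section \<open>Conditioning on the sigma-algebra generated by a random variable\<close>

lemma space_sigma_gen [simp]: "space (sigma_gen M V) = space M"
  by (simp add: sigma_gen_def)

lemma sets_sigma_gen: "sets (sigma_gen M V) = {V -` A \<inter> space M | A. A \<in> sets borel}"
  unfolding sigma_gen_def by (rule sets_vimage_algebra2) simp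

lemma subalgebra_sigma_gen:
  assumes "V \<in> borel_measurable M"
  shows "subalgebra M (sigma_gen M V)"
  using assms by (auto simp: subalgebra_def sets_sigma_gen)

lemma finite_measure_subalgebra_sigma_gen:
  assumes "prob_space N" "V \<in> borel_measurable N"
  shows "finite_measure_subalgebra N (sigma_gen N V)"
  using assms subalgebra_sigma_gen
  by (simp add: finite_measure_subalgebra_def finite_measure_subalgebra_axioms_def
      prob_space.finite_measure)

lemma (in prob_space) integrable_of_bool:
  assumes "Measurable.pred M P"
  shows "integrable M (\<lambda>\<omega>. of_bool (P \<omega>) :: real)"
  using assms by (intro integrable_const_bound[where B = 1]) auto

text \<open>The indicator of \<open>A\<close> is measurable with respect to \<open>F\<close>, so it
  comes out of the conditional expectation. Multiplying both functions by it reduces the claim to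
  global monotonicity.\<close>

lemma (in sigma_finite_subalgebra) real_cond_exp_mono_on:
  assumes A: "A \<in> sets F" and f [measurable]: "integrable M f" and g [measurable]: "integrable M g"
    and le: "AE x in M. x \<in> A \<longrightarrow> f x \<le> g x"
  shows "AE x in M. x \<in> A \<longrightarrow> real_cond_exp M F f x \<le> real_cond_exp M F g x"
proof -
  have AM: "A \<in> sets M" using A subalg by (auto simp: subalgebra_def)
  have int: "integrable M (\<lambda>x. indicator A x * h x)" if "integrable M h" for h :: "'a \<Rightarrow> real"
    using integrable_mult_indicator[OF AM that] by simp
  have ind: "AE x in M. real_cond_exp M F (\<lambda>x. indicator A x * h x) x = indicator A x * real_cond_exp M F h x"
    if "integrable M h" for h
    using that A by (intro real_cond_exp_mult int) auto
  have "AE x in M. real_cond_exp M F (\<lambda>x. indicator A x * f x) x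
      \<le> real_cond_exp M F (\<lambda>x. indicator A x * g x) x"
    using le by (intro real_cond_exp_mono int f g) (auto simp: indicator_def elim!: eventually_mono)
  with ind[OF f] ind[OF g] show ?thesis
    by eventually_elim (auto simp: indicator_def)
qed

text \<open>This trades conditional expectations for probabilities of events, which can be compared
  across different probability spaces. It holds because \<open>cond_prob_given N V P\<close> is
  characterised by its integrals over the events that \<open>V\<close> generates.\<close>

lemma cond_prob_given_ge_iff:
  fixes V :: "'a \<Rightarrow> 'b::topological_space" and c :: real
  assumes "prob_space N" and V [measurable]: "V \<in> borel_measurable N"
    and P [measurable]: "Measurable.pred N P"
  shows "(AE \<omega> in N. c \<le> cond_prob_given N V P \<omega>) \<longleftrightarrow>
    (\<forall>A\<in>sets borel. c * measure N {\<omega>\<in>space N. V \<omega> \<in> A} \<le> measure N {\<omega>\<in>space N. V \<omega> \<in> A \<and> P \<omega>})"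
proof -
  interpret N: prob_space N by fact
  let ?F = "sigma_gen N V"
  interpret finite_measure_subalgebra N ?F
    by (rule finite_measure_subalgebra_sigma_gen) fact+
  let ?ce = "cond_prob_given N V P"
  have intP: "integrable N (\<lambda>\<omega>. of_bool (P \<omega>) :: real)"
    by (rule N.integrable_of_bool) measurable
  have int_ce: "integrable N ?ce"
    unfolding cond_prob_given_def by (rule real_cond_exp_int(1)[OF intP])
  have ce_F: "?ce \<in> borel_measurable ?F"
    unfolding cond_prob_given_def by simp
  \<comment> \<open>Subtracting \<open>c\<close> turns the inequality for \<open>A\<close> into
    nonnegativity of a single integral, from which both directions are read off.\<close>
  have key: "integrable N (\<lambda>\<omega>. indicator A (V \<omega>) * (?ce \<omega> - c))"
      "(\<integral>\<omega>. indicator A (V \<omega>) * (?ce \<omega> - c) \<partial>N)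
        = measure N {\<omega>\<in>space N. V \<omega> \<in> A \<and> P \<omega>} - c * measure N {\<omega>\<in>space N. V \<omega> \<in> A}"
    if A [measurable]: "A \<in> sets borel" for A
  proof -
    have BF: "V -` A \<inter> space N \<in> sets ?F" using A by (auto simp: sets_sigma_gen)
    have BN: "V -` A \<inter> space N \<in> sets N" by measurable
    have i: "integrable N (\<lambda>\<omega>. indicator A (V \<omega>) * h \<omega>)" if "integrable N h" for h :: "'a \<Rightarrow> real"
      using integrable_mult_indicator[OF BN that]
      by (rule Bochner_Integration.integrable_cong[THEN iffD1, rotated 2])
         (auto simp: indicator_def)
    show "integrable N (\<lambda>\<omega>. indicator A (V \<omega>) * (?ce \<omega> - c))"
      by (intro i) (use int_ce in auto)
    have set_eq: "(\<integral>\<omega>. indicator A (V \<omega>) * h \<omega> \<partial>N) = (\<integral>\<omega>\<in>V -` A \<inter> space N. h \<omega> \<partial>N)"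
      for h :: "'a \<Rightarrow> real"
      unfolding set_lebesgue_integral_def
      by (rule Bochner_Integration.integral_cong) (auto simp: indicator_def)
    have ind: "(\<integral>\<omega>. of_bool (Q \<omega>) \<partial>N) = measure N {\<omega>\<in>space N. Q \<omega>}"
      if "Measurable.pred N Q" for Q
    proof -
      have "(\<integral>\<omega>. of_bool (Q \<omega>) \<partial>N) = (\<integral>\<omega>. indicator {\<omega>\<in>space N. Q \<omega>} \<omega> \<partial>N :: real)"
        by (rule Bochner_Integration.integral_cong) (auto simp: indicator_def)
      also have "\<dots> = measure N {\<omega>\<in>space N. Q \<omega>}"
        using that by (subst Bochner_Integration.integral_indicator) (auto intro!: arg_cong[where f = "measure N"])
      finally show ?thesis .
    qed
    have "(\<integral>\<omega>. indicator A (V \<omega>) * ?ce \<omega> \<partial>N) = (\<integral>\<omega>. indicator A (V \<omega>) * of_bool (P \<omega>) \<partial>N)"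
      unfolding set_eq cond_prob_given_def by (rule real_cond_exp_intA[OF intP BF, symmetric])
    also have "\<dots> = (\<integral>\<omega>. of_bool (V \<omega> \<in> A \<and> P \<omega>) \<partial>N)"
      by (rule Bochner_Integration.integral_cong) (auto simp: indicator_def)
    also have "\<dots> = measure N {\<omega>\<in>space N. V \<omega> \<in> A \<and> P \<omega>}"
      by (rule ind) measurable
    finally have 1: "(\<integral>\<omega>. indicator A (V \<omega>) * ?ce \<omega> \<partial>N) = measure N {\<omega>\<in>space N. V \<omega> \<in> A \<and> P \<omega>}" .
    have "(\<integral>\<omega>. indicator A (V \<omega>) * c \<partial>N) = (\<integral>\<omega>. of_bool (V \<omega> \<in> A) * c \<partial>N)"
      by (rule Bochner_Integration.integral_cong) (auto simp: indicator_def)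
    also have "\<dots> = c * (\<integral>\<omega>. of_bool (V \<omega> \<in> A) \<partial>N)"
      by simp
    also have "(\<integral>\<omega>. of_bool (V \<omega> \<in> A) \<partial>N) = measure N {\<omega>\<in>space N. V \<omega> \<in> A}"
      by (rule ind) measurable
    finally have 2: "(\<integral>\<omega>. indicator A (V \<omega>) * c \<partial>N) = c * measure N {\<omega>\<in>space N. V \<omega> \<in> A}" .
    show "(\<integral>\<omega>. indicator A (V \<omega>) * (?ce \<omega> - c) \<partial>N)
        = measure N {\<omega>\<in>space N. V \<omega> \<in> A \<and> P \<omega>} - c * measure N {\<omega>\<in>space N. V \<omega> \<in> A}"
      unfolding right_diff_distrib
        Bochner_Integration.integral_diff[OF i[OF int_ce] i[OF N.integrable_const]] 1 2 ..
  qed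
  show ?thesis
  proof (intro iffI ballI)
    fix A :: "'b set" assume ae: "AE \<omega> in N. c \<le> ?ce \<omega>" and A: "A \<in> sets borel"
    have "0 \<le> (\<integral>\<omega>. indicator A (V \<omega>) * (?ce \<omega> - c) \<partial>N)"
      by (rule integral_nonneg_AE) (use ae in eventually_elim, auto simp: indicator_def)
    then show "c * measure N {\<omega>\<in>space N. V \<omega> \<in> A} \<le> measure N {\<omega>\<in>space N. V \<omega> \<in> A \<and> P \<omega>}"
      using key(2)[OF A] by simp
  next
    assume le: "\<forall>A\<in>sets borel. c * measure N {\<omega>\<in>space N. V \<omega> \<in> A}
      \<le> measure N {\<omega>\<in>space N. V \<omega> \<in> A \<and> P \<omega>}"
    \<comment> \<open>The exceptional set is itself generated by \<open>V\<close>, hence a preimage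
      of some Borel \<open>A\<close>. Testing the hypothesis on this \<open>A\<close> forces the
      nonnegative function \<open>?h\<close> to have integral zero, so the exceptional set is
      null.\<close>
    have "{\<omega>\<in>space ?F. ?ce \<omega> < c} \<in> sets ?F"
      using ce_F by measurable
    then obtain A where A: "A \<in> sets borel" and eq: "{\<omega>\<in>space N. ?ce \<omega> < c} = V -` A \<inter> space N"
      by (auto simp: sets_sigma_gen)
    have below: "V \<omega> \<in> A \<longleftrightarrow> ?ce \<omega> < c" if "\<omega> \<in> space N" for \<omega>
      using eq that by blast
    let ?h = "\<lambda>\<omega>. indicator A (V \<omega>) * (c - ?ce \<omega>)"
    have h: "?h = (\<lambda>\<omega>. - (indicator A (V \<omega>) * (?ce \<omega> - c)))" by (auto simp: algebra_simps)
    have int_h: "integrable N ?h" unfolding h using key(1)[OF A] by simp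
    have nn: "AE \<omega> in N. 0 \<le> ?h \<omega>"
      by (rule AE_I2) (auto simp: below indicator_def)
    have "(\<integral>\<omega>. ?h \<omega> \<partial>N) \<le> 0"
      unfolding h using key(2)[OF A] le A by simp
    with integral_nonneg_AE[OF nn] have "(\<integral>\<omega>. ?h \<omega> \<partial>N) = 0" by simp
    then have "AE \<omega> in N. ?h \<omega> = 0"
      using integral_nonneg_eq_0_iff_AE[OF int_h nn] by simp
    then show "AE \<omega> in N. c \<le> ?ce \<omega>"
      using AE_space by eventually_elim (auto simp: below indicator_def split: if_splits)
  qed
qed

section \<open>Invariance under the joint law of regressor and error\<close>

text \<open>By \<open>cond_prob_given_ge_iff\<close>, both median inequalities concern only
  probabilities of events in the pair \<open>(V, U)\<close>, and these are determined by its law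
  even when the two sample spaces differ.\<close>

lemma is_cond_median_cong_law:
  fixes V :: "'a \<Rightarrow> 'b::second_countable_topology" and V' :: "'c \<Rightarrow> 'b"
  assumes N: "prob_space N" "V \<in> borel_measurable N" "U \<in> borel_measurable N"
    and N': "prob_space N'" "V' \<in> borel_measurable N'" "U' \<in> borel_measurable N'"
    and law: "distr N borel (\<lambda>\<omega>. (V \<omega>, U \<omega>)) = distr N' borel (\<lambda>\<omega>. (V' \<omega>, U' \<omega>))"
  shows "is_cond_median N V U m \<longleftrightarrow> is_cond_median N' V' U' m"
proof -
  note [measurable] = N(2,3) N'(2,3)
  have fst_borel: "fst \<in> borel_measurable (borel :: ('b \<times> real) measure)"
    and snd_borel: "snd \<in> borel_measurable (borel :: ('b \<times> real) measure)"
    by (simp_all add: borel_prod[symmetric])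
  note [measurable] = fst_borel snd_borel
  have prob: "measure N {\<omega>\<in>space N. Q (V \<omega>, U \<omega>)} = measure N' {\<omega>\<in>space N'. Q (V' \<omega>, U' \<omega>)}"
    if [measurable]: "Measurable.pred borel Q" for Q :: "'b \<times> real \<Rightarrow> bool"
  proof -
    have Q: "{p. Q p} \<in> sets borel" using that by simp
    have "measure N {\<omega>\<in>space N. Q (V \<omega>, U \<omega>)} = measure (distr N borel (\<lambda>\<omega>. (V \<omega>, U \<omega>))) {p. Q p}"
      using Q by (subst measure_distr) (auto intro!: arg_cong[where f = "measure N"])
    also have "\<dots> = measure N' {\<omega>\<in>space N'. Q (V' \<omega>, U' \<omega>)}"
      unfolding law
      using Q by (subst measure_distr) (auto intro!: arg_cong[where f = "measure N'"])
    finally show ?thesis .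
  qed
  have "(AE \<omega> in N. c \<le> cond_prob_given N V (\<lambda>\<omega>. R (U \<omega>)) \<omega>) \<longleftrightarrow>
      (AE \<omega> in N'. c \<le> cond_prob_given N' V' (\<lambda>\<omega>. R (U' \<omega>)) \<omega>)"
    if [measurable]: "Measurable.pred borel R" for R c
  proof -
    have "measure N {\<omega>\<in>space N. V \<omega> \<in> A} = measure N' {\<omega>\<in>space N'. V' \<omega> \<in> A}"
      "measure N {\<omega>\<in>space N. V \<omega> \<in> A \<and> R (U \<omega>)} = measure N' {\<omega>\<in>space N'. V' \<omega> \<in> A \<and> R (U' \<omega>)}"
      if [measurable]: "A \<in> sets borel" for A
      using prob[of "\<lambda>p. fst p \<in> A"] prob[of "\<lambda>p. fst p \<in> A \<and> R (snd p)"] by simp_all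
    then show ?thesis
      using N N' by (simp add: cond_prob_given_ge_iff)
  qed
  from this[of "\<lambda>u. u \<le> m" "1/2"] this[of "\<lambda>u. m \<le> u" "1/2"] show ?thesis
    by (simp add: is_cond_median_def)
qed

text \<open>The law of \<open>V\<close> and that of \<open>V\<close> with its response are images of
  the law of \<open>(V, U)\<close> under fixed Borel maps, and the median condition is invariant by
  the previous lemma. So one representation carries over to every pair with the same law.\<close>

lemma response_representation_cong_law:
  fixes V :: "'a \<Rightarrow> 'b::euclidean_space" and V' :: "'c \<Rightarrow> 'b"
  assumes rep: "response_representation M X Y \<beta> N' V' U'" and N': "prob_space N'"
    and N: "prob_space N" "V \<in> borel_measurable N" "U \<in> borel_measurable N"
    and law: "distr N borel (\<lambda>\<omega>. (V \<omega>, U \<omega>)) = distr N' borel (\<lambda>\<omega>. (V' \<omega>, U' \<omega>))"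
  shows "response_representation M X Y \<beta> N V U"
proof -
  have meas': "V' \<in> borel_measurable N'" "U' \<in> borel_measurable N'"
    using rep by (auto simp: response_representation_def)
  note [measurable] = N(2,3) meas'
  have push: "distr N borel (\<lambda>\<omega>. g (V \<omega>, U \<omega>)) = distr N' borel (\<lambda>\<omega>. g (V' \<omega>, U' \<omega>))"
    if [measurable]: "g \<in> borel_measurable borel" for g :: "'b \<times> real \<Rightarrow> 'e::topological_space"
  proof -
    have "distr N borel (\<lambda>\<omega>. g (V \<omega>, U \<omega>)) = distr (distr N borel (\<lambda>\<omega>. (V \<omega>, U \<omega>))) borel g"
      by (subst distr_distr) (auto simp: comp_def)
    also have "\<dots> = distr N' borel (\<lambda>\<omega>. g (V' \<omega>, U' \<omega>))"
      unfolding law by (subst distr_distr) (auto simp: comp_def)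
    finally show ?thesis .
  qed
  have [measurable]: "(fst :: 'b \<times> real \<Rightarrow> 'b) \<in> borel_measurable borel"
    "(\<lambda>p. (fst p, of_bool (snd p + \<beta> \<bullet> fst p \<ge> 0) :: real)) \<in> borel_measurable borel"
    by (simp_all add: borel_prod[symmetric])
  have "distr N borel V = distr N' borel V'"
    using push[of fst] by simp
  moreover have "distr N borel (\<lambda>\<omega>. (V \<omega>, binary_response \<beta> V U \<omega>))
      = distr N' borel (\<lambda>\<omega>. (V' \<omega>, binary_response \<beta> V' U' \<omega>))"
    using push[of "\<lambda>p. (fst p, of_bool (snd p + \<beta> \<bullet> fst p \<ge> 0) :: real)"]
    by (simp add: binary_response_def)
  moreover have "is_cond_median N V U 0 \<longleftrightarrow> is_cond_median N' V' U' 0"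
    by (rule is_cond_median_cong_law) (use N N' meas' law in auto)
  ultimately show ?thesis
    using rep N(2,3) by (simp add: response_representation_def)
qed

section \<open>Null sets of a law with a density\<close>

text \<open>Absolute continuity of the law of \<open>X\<close>; it serves to discard the hyperplane
  orthogonal to \<beta> and the frontier of \<open>S\<close>.\<close>

lemma AE_distributed_not_in_negligible:
  fixes X :: "'a \<Rightarrow> 'b::euclidean_space"
  assumes X: "distributed M lborel X f" and B: "negligible B" "B \<in> sets borel"
  shows "AE \<omega> in M. X \<omega> \<notin> B"
proof -
  \<comment> \<open>\<open>negligible\<close> refers to the completed Lebesgue measure; for a Borel
    set, being null there and being null for \<open>lborel\<close> coincide.\<close>
  have "B \<in> null_sets lborel"
    using B by (simp add: negligible_iff_null_sets null_sets_completion_iff)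
  then have "AE x in lborel. x \<notin> B" by (rule AE_not_in)
  then have "AE x in density lborel f. x \<notin> B"
    using X by (subst AE_density) (auto simp: distributed_def)
  then have "AE x in distr M lborel X. x \<notin> B"
    using distributed_distr_eq_density[OF X] by metis
  then show ?thesis
    using X B(2) by (subst (asm) AE_distr_iff) (auto simp: distributed_def)
qed

section \<open>Sign condition and median-zero errors on the original probability space\<close>

context
  fixes M :: "'a measure" and X :: "'a \<Rightarrow> 'b::euclidean_space" and Y :: "'a \<Rightarrow> real"
    and \<kappa> :: "'b \<Rightarrow> real"
  assumes M: "prob_space M"
    and X [measurable]: "X \<in> borel_measurable M"
    and Y [measurable]: "Y \<in> borel_measurable M"
    and Y01: "\<forall>\<omega>\<in>space M. Y \<omega> \<in> {0, 1}"
    and \<kappa>: "regression_version M X Y \<kappa>"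
begin

interpretation M: prob_space M by (fact M)

interpretation F: finite_measure_subalgebra M "sigma_gen M X"
  by (rule finite_measure_subalgebra_sigma_gen) (fact M X)+

lemma integrable_response: "integrable M Y"
  using Y01 by (intro M.integrable_const_bound[where B = 1] AE_I2) auto

lemma real_cond_exp_response:
  "AE \<omega> in M. real_cond_exp M (sigma_gen M X) Y \<omega> = \<kappa> (X \<omega>)"
  using \<kappa> by (simp add: regression_version_def)

lemma real_cond_exp_complement:
  "AE \<omega> in M. real_cond_exp M (sigma_gen M X) (\<lambda>\<omega>. 1 - Y \<omega>) \<omega> = 1 - \<kappa> (X \<omega>)"
proof -
  have 1: "AE \<omega> in M. real_cond_exp M (sigma_gen M X) (\<lambda>\<omega>. 1 - Y \<omega>) \<omega>
      = real_cond_exp M (sigma_gen M X) (\<lambda>\<omega>. 1) \<omega> - real_cond_exp M (sigma_gen M X) Y \<omega>"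
    by (rule F.real_cond_exp_diff) (auto simp: integrable_response)
  have 2: "AE \<omega> in M. real_cond_exp M (sigma_gen M X) (\<lambda>\<omega>. 1) \<omega> = 1"
    by (rule F.real_cond_exp_F_meas) auto
  from 1 2 real_cond_exp_response show ?thesis by eventually_elim simp
qed

lemma real_cond_exp_mono_given:
  fixes g h :: "'a \<Rightarrow> real"
  assumes "B \<in> sets borel" "integrable M g" "integrable M h"
    and "AE \<omega> in M. X \<omega> \<in> B \<longrightarrow> g \<omega> \<le> h \<omega>"
  shows "AE \<omega> in M. X \<omega> \<in> B \<longrightarrow>
    real_cond_exp M (sigma_gen M X) g \<omega> \<le> real_cond_exp M (sigma_gen M X) h \<omega>"
proof -
  have "X -` B \<inter> space M \<in> sets (sigma_gen M X)"
    using assms(1) by (auto simp: sets_sigma_gen)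
  from F.real_cond_exp_mono_on[OF this assms(2,3)] assms(4) AE_space show ?thesis
    by (auto elim!: eventually_mono eventually_elim2)
qed

lemma halfspace_sets:
  "{x. 0 \<le> \<beta> \<bullet> x} \<in> sets (borel :: 'b measure)" "{x. 0 < \<beta> \<bullet> x} \<in> sets (borel :: 'b measure)"
  "{x. \<beta> \<bullet> x < 0} \<in> sets (borel :: 'b measure)"
  by measurable

text \<open>Each half-space uses one half of the median condition: \<open>U \<ge> 0\<close> bounds
  \<kappa> from below by 1/2 where \<open>\<beta> \<bullet> X \<ge> 0\<close>, and
  \<open>U \<le> 0\<close> bounds \<open>1 - \<kappa>\<close> from below by 1/2 where
  \<open>\<beta> \<bullet> X < 0\<close>. The hyperplane goes with the first case, where the product
  is zero anyway.\<close>

lemma sign_condition_if_median_response: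
  assumes U [measurable]: "U \<in> borel_measurable M" and med: "is_cond_median M X U 0"
    and resp: "AE \<omega> in M. Y \<omega> = binary_response \<beta> X U \<omega>"
  shows "AE \<omega> in M. (\<beta> \<bullet> X \<omega>) * (\<kappa> (X \<omega>) - 1/2) \<ge> 0"
proof -
  have pred: "Measurable.pred M (\<lambda>\<omega>. U \<omega> \<ge> 0)" "Measurable.pred M (\<lambda>\<omega>. U \<omega> \<le> 0)"
    by measurable
  note int_U = pred[THEN M.integrable_of_bool]
  have compl: "integrable M (\<lambda>\<omega>. 1 - Y \<omega>)"
    by (auto simp: integrable_response)
  have "AE \<omega> in M. X \<omega> \<in> {x. 0 \<le> \<beta> \<bullet> x} \<longrightarrow>
      cond_prob_given M X (\<lambda>\<omega>. U \<omega> \<ge> 0) \<omega> \<le> real_cond_exp M (sigma_gen M X) Y \<omega>"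
    unfolding cond_prob_given_def
    by (rule real_cond_exp_mono_given[OF halfspace_sets(1) int_U(1) integrable_response])
       (use resp in eventually_elim, auto simp: binary_response_def)
  moreover have "AE \<omega> in M. X \<omega> \<in> {x. \<beta> \<bullet> x < 0} \<longrightarrow>
      cond_prob_given M X (\<lambda>\<omega>. U \<omega> \<le> 0) \<omega> \<le> real_cond_exp M (sigma_gen M X) (\<lambda>\<omega>. 1 - Y \<omega>) \<omega>"
    unfolding cond_prob_given_def
    by (rule real_cond_exp_mono_given[OF halfspace_sets(3) int_U(2) compl])
       (use resp in eventually_elim, auto simp: binary_response_def)
  ultimately show ?thesis
    using real_cond_exp_response real_cond_exp_complement med[unfolded is_cond_median_def]
    by eventually_elim (auto simp: zero_le_mult_iff not_le)
qed

text \<open>Resetting \<kappa> to 1/2 wherever the sign condition fails makes the product vanish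
  there. By assumption this changes \<kappa> only on a null set of the law of \<open>X\<close>, so
  the result is still a version.\<close>

lemma regression_version_on_set:
  assumes ae: "AE \<omega> in M. (\<beta> \<bullet> X \<omega>) * (\<kappa> (X \<omega>) - 1/2) \<ge> 0"
  obtains \<kappa>' where "regression_version M X Y \<kappa>'" "\<And>x. (\<beta> \<bullet> x) * (\<kappa>' x - 1/2) \<ge> 0"
proof
  let ?k = "\<lambda>x. if (\<beta> \<bullet> x) * (\<kappa> x - 1/2) \<ge> 0 then \<kappa> x else 1/2"
  have [measurable]: "\<kappa> \<in> borel_measurable borel"
    using \<kappa> by (simp add: regression_version_def)
  have "AE \<omega> in M. real_cond_exp M (sigma_gen M X) Y \<omega> = ?k (X \<omega>)"
    using ae real_cond_exp_response by eventually_elim auto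
  then show "regression_version M X Y ?k"
    by (simp add: regression_version_def)
  show "(\<beta> \<bullet> x) * (?k x - 1/2) \<ge> 0" for x by simp
qed

lemma response_representation_if_sign_condition:
  assumes nz: "AE \<omega> in M. \<beta> \<bullet> X \<omega> \<noteq> 0"
    and sign: "AE \<omega> in M. (\<beta> \<bullet> X \<omega>) * (\<kappa> (X \<omega>) - 1/2) \<ge> 0"
  obtains U where "response_representation M X Y \<beta> M X U"
proof
  \<comment> \<open>With \<open>t = \<beta> \<bullet> X\<close>, the sum \<open>U + t\<close> is
    \<open>t\<close> when the sign of \<open>t\<close> already predicts \<open>Y\<close>, and
    \<open>-t\<close> otherwise. The reflection flips the response only if \<open>t\<close> is
    nonzero, which is where \<open>nz\<close> enters.\<close>
  define U where "U \<omega> = (if Y \<omega> = of_bool (\<beta> \<bullet> X \<omega> \<ge> 0) then 0 else - 2 * (\<beta> \<bullet> X \<omega>))" for \<omega>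
  have U [measurable]: "U \<in> borel_measurable M" unfolding U_def by measurable
  have pred: "Measurable.pred M (\<lambda>\<omega>. U \<omega> \<ge> 0)" "Measurable.pred M (\<lambda>\<omega>. U \<omega> \<le> 0)"
    by measurable
  note int_U = pred[THEN M.integrable_of_bool]
  have compl: "integrable M (\<lambda>\<omega>. 1 - Y \<omega>)" and const: "integrable M (\<lambda>\<omega>. 1 :: real)"
    by (auto simp: integrable_response)
  \<comment> \<open>For \<open>t > 0\<close> the error is never positive and vanishes when
    \<open>Y = 1\<close>; for \<open>t < 0\<close> it is never negative and vanishes when
    \<open>Y = 0\<close>. Facts \<open>1\<close> and \<open>2\<close> therefore give the lower
    bounds \<kappa> and \<open>1 - \<kappa>\<close>, which the sign condition puts above 1/2, while
    \<open>3\<close> and \<open>4\<close> give the bound 1 for the opposite tails.\<close>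
  have 1: "AE \<omega> in M. X \<omega> \<in> {x. 0 < \<beta> \<bullet> x} \<longrightarrow> real_cond_exp M (sigma_gen M X) Y \<omega>
      \<le> cond_prob_given M X (\<lambda>\<omega>. U \<omega> \<ge> 0) \<omega>"
    unfolding cond_prob_given_def
    by (rule real_cond_exp_mono_given[OF halfspace_sets(2) integrable_response int_U(1)], rule AE_I2)
       (use Y01 in \<open>auto simp: U_def\<close>)
  have 2: "AE \<omega> in M. X \<omega> \<in> {x. \<beta> \<bullet> x < 0} \<longrightarrow> real_cond_exp M (sigma_gen M X) (\<lambda>\<omega>. 1 - Y \<omega>) \<omega>
      \<le> cond_prob_given M X (\<lambda>\<omega>. U \<omega> \<le> 0) \<omega>"
    unfolding cond_prob_given_def
    by (rule real_cond_exp_mono_given[OF halfspace_sets(3) compl int_U(2)], rule AE_I2)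
       (use Y01 in \<open>auto simp: U_def\<close>)
  have 3: "AE \<omega> in M. X \<omega> \<in> {x. \<beta> \<bullet> x < 0} \<longrightarrow> real_cond_exp M (sigma_gen M X) (\<lambda>\<omega>. 1) \<omega>
      \<le> cond_prob_given M X (\<lambda>\<omega>. U \<omega> \<ge> 0) \<omega>"
    unfolding cond_prob_given_def
    by (rule real_cond_exp_mono_given[OF halfspace_sets(3) const int_U(1)], rule AE_I2)
       (auto simp: U_def)
  have 4: "AE \<omega> in M. X \<omega> \<in> {x. 0 < \<beta> \<bullet> x} \<longrightarrow> real_cond_exp M (sigma_gen M X) (\<lambda>\<omega>. 1) \<omega>
      \<le> cond_prob_given M X (\<lambda>\<omega>. U \<omega> \<le> 0) \<omega>"
    unfolding cond_prob_given_def
    by (rule real_cond_exp_mono_given[OF halfspace_sets(2) const int_U(2)], rule AE_I2)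
       (auto simp: U_def)
  have one: "AE \<omega> in M. real_cond_exp M (sigma_gen M X) (\<lambda>\<omega>. 1) \<omega> = 1"
    by (rule F.real_cond_exp_F_meas) auto
  have med: "is_cond_median M X U 0"
    unfolding is_cond_median_def
    using 1 2 3 4 one nz sign real_cond_exp_response real_cond_exp_complement
  proof eventually_elim
    case (elim \<omega>)
    show ?case
    proof (cases "0 < \<beta> \<bullet> X \<omega>")
      case True
      then have "\<kappa> (X \<omega>) \<ge> 1/2" using elim(7) by (simp add: zero_le_mult_iff)
      then show ?thesis using True elim(1,4,5,8) by simp
    next
      case False
      then have neg: "\<beta> \<bullet> X \<omega> < 0" using elim(6) by simp
      then have "\<kappa> (X \<omega>) \<le> 1/2" using elim(7) by (simp add: zero_le_mult_iff)
      then show ?thesis using neg elim(2,3,5,9) by simp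
    qed
  qed
  have resp: "AE \<omega> in M. (X \<omega>, Y \<omega>) = (X \<omega>, binary_response \<beta> X U \<omega>)"
    using nz AE_space
  proof eventually_elim
    case (elim \<omega>)
    then show ?case using Y01 by (auto simp: binary_response_def U_def)
  qed
  have [measurable]: "binary_response \<beta> X U \<in> borel_measurable M"
    unfolding binary_response_def[abs_def] by measurable
  have "distr M borel (\<lambda>\<omega>. (X \<omega>, Y \<omega>)) = distr M borel (\<lambda>\<omega>. (X \<omega>, binary_response \<beta> X U \<omega>))"
    by (rule distr_cong_AE[OF refl refl resp]) measurable
  with med show "response_representation M X Y \<beta> M X U"
    using X U by (simp add: response_representation_def)
qed

end

text \<open>Since \<kappa> is determined only up to null sets of the law of \<open>X\<close>, claim
  (i) takes two forms: almost everywhere for the given \<kappa>, and pointwise on \<open>S\<close>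
  for a suitable version.\<close>

theorem lemmaB1:
  fixes M :: "'a measure"
    and S :: "(real ^ 'n) set"
    and X :: "'a \<Rightarrow> real ^ 'n"
    and Y :: "'a \<Rightarrow> real"
    and f :: "real ^ 'n \<Rightarrow> ennreal"
    and \<kappa> :: "real ^ 'n \<Rightarrow> real"
  assumes "prob_space M"
    and "CARD('n) \<ge> 2"
    and "compact S" and "convex S" and "interior S \<noteq> {}"
    and "X \<in> borel_measurable M" and "\<forall>\<omega>\<in>space M. X \<omega> \<in> S"
    and "distributed M lborel X f" and "\<forall>x\<in>interior S. f x > 0"
    and "Y \<in> borel_measurable M" and "\<forall>\<omega>\<in>space M. Y \<omega> \<in> {0, 1}"
    and "regression_version M X Y \<kappa>"
  shows
    "(\<forall>\<beta>\<^sub>0 \<in> sphere 0 1.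
        (\<exists>U \<in> borel_measurable M. is_cond_median M X U 0 \<and>
            (AE \<omega> in M. Y \<omega> = binary_response \<beta>\<^sub>0 X U \<omega>)) \<longrightarrow>
        (AE x in distr M borel X. (\<beta>\<^sub>0 \<bullet> x) * (\<kappa> x - 1/2) \<ge> 0) \<and>
        (\<exists>\<kappa>'. regression_version M X Y \<kappa>' \<and>
            (\<forall>x\<in>S. (\<beta>\<^sub>0 \<bullet> x) * (\<kappa>' x - 1/2) \<ge> 0)))
     \<and>
     (\<forall>\<beta>\<^sub>0 \<in> sphere 0 1.
        measure M {\<omega> \<in> space M. \<kappa> (X \<omega>) \<in> {0, 1/2, 1}} = 0 \<and>
        (\<forall>x\<in>interior S. (\<beta>\<^sub>0 \<bullet> x) * (\<kappa> x - 1/2) \<ge> 0) \<longrightarrow>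
        (\<exists>\<mu> :: ((real ^ 'n) \<times> real) measure.
            prob_space \<mu> \<and> sets \<mu> = sets borel \<and>
            response_representation M X Y \<beta>\<^sub>0 \<mu> fst snd \<and>
            (\<forall>(N :: 'c measure) V U.
                prob_space N \<and> V \<in> borel_measurable N \<and> U \<in> borel_measurable N \<and>
                distr N borel (\<lambda>\<omega>. (V \<omega>, U \<omega>)) = \<mu> \<longrightarrow>
                response_representation M X Y \<beta>\<^sub>0 N V U)) \<and>
        ((\<exists>Z \<in> borel_measurable M.
            continuous_on UNIV (cdf (distr M borel Z)) \<and>
            strict_mono (cdf (distr M borel Z)) \<and>
            distr M borel (\<lambda>\<omega>. - Z \<omega>) = distr M borel Z \<and>
            indep_rv M Z X) \<longrightarrow>
         (\<exists>U. response_representation M X Y \<beta>\<^sub>0 M X U)))"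
proof (intro conjI ballI impI; (elim conjE bexE)?)
  note asm = assms(1,6,10,11,12)
  interpret prob_space M by fact
  note [measurable] = assms(6,10)
  have [measurable]: "\<kappa> \<in> borel_measurable borel"
    using assms(12) by (simp add: regression_version_def)
  \<comment> \<open>The first block settles both forms of (i); the second derives (ii) and (iii)
    from one and the same \<open>U\<close> on \<open>M\<close>.\<close>
  {
    fix \<beta> U
    assume "U \<in> borel_measurable M" "is_cond_median M X U 0"
      "AE \<omega> in M. Y \<omega> = binary_response \<beta> X U \<omega>"
    then have sign: "AE \<omega> in M. (\<beta> \<bullet> X \<omega>) * (\<kappa> (X \<omega>) - 1/2) \<ge> 0"
      by (rule sign_condition_if_median_response[OF asm])
    then show "AE x in distr M borel X. (\<beta> \<bullet> x) * (\<kappa> x - 1/2) \<ge> 0"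
      by (subst AE_distr_iff) auto
    show "\<exists>\<kappa>'. regression_version M X Y \<kappa>' \<and> (\<forall>x\<in>S. (\<beta> \<bullet> x) * (\<kappa>' x - 1/2) \<ge> 0)"
      using regression_version_on_set[OF asm sign] by metis
  next
    fix \<beta> :: "real ^ 'n"
    assume \<beta>: "\<beta> \<in> sphere 0 1" and int: "\<forall>x\<in>interior S. (\<beta> \<bullet> x) * (\<kappa> x - 1/2) \<ge> 0"
    have "\<beta> \<noteq> 0" using \<beta> by auto
    then have nz: "AE \<omega> in M. \<beta> \<bullet> X \<omega> \<noteq> 0"
      using AE_distributed_not_in_negligible[OF assms(8), of "{x. \<beta> \<bullet> x = 0}"]
      by (simp add: negligible_hyperplane)
    \<comment> \<open>The sign condition is given only on the interior. The frontier of a convex set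
      is Lebesgue null and \<open>S\<close> is closed, so \<open>X\<close> lies in the interior
      almost surely.\<close>
    have "AE \<omega> in M. X \<omega> \<notin> frontier S"
      using assms(4) by (intro AE_distributed_not_in_negligible[OF assms(8)]
          negligible_convex_frontier) auto
    then have sign: "AE \<omega> in M. (\<beta> \<bullet> X \<omega>) * (\<kappa> (X \<omega>) - 1/2) \<ge> 0"
      using AE_space
      by eventually_elim (use int assms(3,7) in \<open>auto simp: frontier_def compact_imp_closed\<close>)
    obtain U where rep: "response_representation M X Y \<beta> M X U"
      by (rule response_representation_if_sign_condition[OF asm nz sign])
    then have [measurable]: "U \<in> borel_measurable M"
      by (simp add: response_representation_def)
    let ?\<mu> = "distr M borel (\<lambda>\<omega>. (X \<omega>, U \<omega>))"
    \<comment> \<open>The sample space type \<open>'z\<close> stays general: the fact is applied to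
      \<open>?\<mu>\<close> itself with its coordinate projections, and then to every
      \<open>N\<close> over \<open>'c\<close>.\<close>
    have transfer: "response_representation M X Y \<beta> N V W"
      if "prob_space N" "V \<in> borel_measurable N" "W \<in> borel_measurable N"
        "distr N borel (\<lambda>\<omega>. (V \<omega>, W \<omega>)) = ?\<mu>"
      for N :: "'z measure" and V W
      by (rule response_representation_cong_law[OF rep assms(1) that])
    have prob: "prob_space ?\<mu>" by (rule prob_space_distr) measurable
    have "response_representation M X Y \<beta> ?\<mu> fst snd"
    proof (rule transfer[OF prob])
      show "fst \<in> borel_measurable ?\<mu>" "snd \<in> borel_measurable ?\<mu>"
        by (simp_all add: borel_prod[symmetric])
      show "distr ?\<mu> borel (\<lambda>\<omega>. (fst \<omega>, snd \<omega>)) = ?\<mu>"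
        by (simp add: distr_id2)
    qed
    with prob transfer show "\<exists>\<mu> :: ((real ^ 'n) \<times> real) measure.
        prob_space \<mu> \<and> sets \<mu> = sets borel \<and> response_representation M X Y \<beta> \<mu> fst snd \<and>
        (\<forall>(N :: 'c measure) V U. prob_space N \<and> V \<in> borel_measurable N \<and> U \<in> borel_measurable N \<and>
          distr N borel (\<lambda>\<omega>. (V \<omega>, U \<omega>)) = \<mu> \<longrightarrow> response_representation M X Y \<beta> N V U)"
      by (intro exI[of _ ?\<mu>]) auto
    show "\<exists>U. response_representation M X Y \<beta> M X U"
      using rep by blast
  }
qed

end
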